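(* Let $\mathcal{G} = (\mathcal{V}_1 \uplus \mathcal{V}_2, \mathcal{L})$ be an exchange graph with vertex set $\mathcal{V} = \mathcal{V}_1 \uplus \mathcal{V}_2$, and let $w : \mathcal{V} \to \mathbb{R}_{\geq 0}$ be non-negative vertex weights. Let $\mathcal{V}_\circ \in \{\mathcal{V}_1, \mathcal{V}_2\}$, and let $\pi_\circ : \mathcal{V} \to \{0,1\}$ be the monolog defined by $\pi_\circ(v) = 1$ if $v \in \mathcal{V}_\circ$ and $\pi_\circ(v) = 0$ otherwise. Then $\pi_\circ$ minimizes the cost function $$f(\pi) = \sum_{v \in \mathcal{V}} w(v)\,\pi(v)$$ among all admissible policies $\pi : \mathcal{V} \to \{0,1\}$ if and only if $$\forall\, \mathcal{S} \subseteq \mathcal{V}_\circ : \qquad \sum_{v \in \mathcal{S}} w(v) \leq \sum_{v \in \mathcal{N}(\mathcal{S})} w(v).$$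
   Context: An exchange graph is a finite undirected bipartite graph $\mathcal{G} = (\mathcal{V}_1 \uplus \mathcal{V}_2, \mathcal{L})$ with two disjoint vertex classes $\mathcal{V}_1, \mathcal{V}_2$ and edge set $\mathcal{L}$, every edge joining a vertex of $\mathcal{V}_1$ to a vertex of $\mathcal{V}_2$; it is assumed that every vertex has degree at least one. Write $u \sim v$ if $u$ and $v$ are joined by an edge. For a set of vertices $\mathcal{S}$, $\mathcal{N}(\mathcal{S})$ denotes the neighbourhood of $\mathcal{S}$, i.e. the set of vertices adjacent to at least one vertex of $\mathcal{S}$. A (data exchange) policy is a map $\pi : \mathcal{V} \to \{0,1\}$, where $\mathcal{V} = \mathcal{V}_1 \uplus \mathcal{V}_2$. A policy is admissible if $\pi(u) + \pi(v) \geq 1$ for all $u \sim v$. A monolog is a policy that equals $1$ on one of the two classes $\mathcal{V}_1, \mathcal{V}_2$ and $0$ on the other. *)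

theory Defs
  imports Complex_Main "HOL-Library.FuncSet"
begin

text \<open>
  An undirected edge is the two-element set of its endpoints.
\<close>

definition graph_degree :: "'a set set \<Rightarrow> 'a \<Rightarrow> nat" where
  "graph_degree L v = card {e \<in> L. v \<in> e}"

definition exchange_graph :: "'a set \<Rightarrow> 'a set \<Rightarrow> 'a set set \<Rightarrow> bool" where
  "exchange_graph V1 V2 L \<longleftrightarrow>
     finite V1 \<and> finite V2 \<and> V1 \<inter> V2 = {} \<and>
     (\<forall>e\<in>L. \<exists>u\<in>V1. \<exists>v\<in>V2. e = {u, v}) \<and>
     (\<forall>v\<in>V1 \<union> V2. graph_degree L v \<ge> 1)"

definition adjacent :: "'a set set \<Rightarrow> 'a \<Rightarrow> 'a \<Rightarrow> bool" where
  "adjacent L u v \<longleftrightarrow> {u, v} \<in> L"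

definition neighbourhood :: "'a set set \<Rightarrow> 'a set \<Rightarrow> 'a set" where
  "neighbourhood L S = {v. \<exists>u\<in>S. adjacent L u v}"

text \<open>
  A map on the vertex set \<open>V\<close> is represented by a total function whose values outside \<open>V\<close>
  are arbitrary; none of the notions below depends on those values.
\<close>

definition policy :: "'a set \<Rightarrow> ('a \<Rightarrow> nat) \<Rightarrow> bool" where
  "policy V \<pi> \<longleftrightarrow> \<pi> \<in> V \<rightarrow> {0, 1}"

definition admissible :: "'a set \<Rightarrow> 'a set set \<Rightarrow> ('a \<Rightarrow> nat) \<Rightarrow> bool" where
  "admissible V L \<pi> \<longleftrightarrow>
     policy V \<pi> \<and> (\<forall>u\<in>V. \<forall>v\<in>V. adjacent L u v \<longrightarrow> \<pi> u + \<pi> v \<ge> 1)"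

definition cost :: "'a set \<Rightarrow> ('a \<Rightarrow> real) \<Rightarrow> ('a \<Rightarrow> nat) \<Rightarrow> real" where
  "cost V w \<pi> = (\<Sum>v\<in>V. w v * real (\<pi> v))"

end

(* Admissible policies are the indicators of vertex covers. Withdrawing the policy from S \<subseteq> Vo
   forces it onto N(S) on the other side, so it changes the cost by w(N(S)) - w(S). Conversely,
   if S is the part of Vo on which an admissible policy vanishes, the policy is 1 on N(S), hence
   costs at least w(Vo) - w(S) + w(N(S)). *)
theory Submission
  imports Defs "HOL-Library.Indicator_Function"
begin

lemma adjacent_commute: "adjacent L u v \<longleftrightarrow> adjacent L v u"
  by (simp add: adjacent_def insert_commute)

lemma exchange_graph_commute: "exchange_graph V1 V2 L \<Longrightarrow> exchange_graph V2 V1 L"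
  unfolding exchange_graph_def by (metis Int_commute Un_commute insert_commute)

text \<open>Edges are unordered pairs, so adjacency alone does not tell which endpoint lies in which
  class; both orientations must be allowed.\<close>

lemma adjacent_cases:
  assumes "exchange_graph A B L" "adjacent L u v"
  shows "u \<in> A \<and> v \<in> B \<or> u \<in> B \<and> v \<in> A"
  using assms unfolding exchange_graph_def adjacent_def by (metis doubleton_eq_iff)

lemma neighbourhood_subset:
  assumes "exchange_graph A B L" "S \<subseteq> A"
  shows "neighbourhood L S \<subseteq> B"
proof -
  have "A \<inter> B = {}"
    using assms(1) by (simp add: exchange_graph_def)
  then show ?thesis
    using adjacent_cases[OF assms(1)] assms(2) unfolding neighbourhood_def by blast
qed

text \<open>With values in {0, 1}, only the support of \<open>\<pi>\<close> contributes. Costs can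
  then be compared through inclusions of supports.\<close>

lemma cost_eq_sum:
  assumes "finite V" "policy V \<pi>"
  shows "cost V w \<pi> = sum w {v \<in> V. \<pi> v = 1}"
proof -
  have "cost V w \<pi> = (\<Sum>v\<in>V. if \<pi> v = 1 then w v else 0)"
    unfolding cost_def using assms(2) by (intro sum.cong) (auto simp: policy_def Pi_iff)
  then show ?thesis
    using assms(1) by (simp add: sum.inter_filter)
qed

text \<open>Every edge has an endpoint in \<open>A\<close>. Either that endpoint survives in
  \<open>A - S\<close>, or it lies in \<open>S\<close> and the other endpoint is in the
  neighbourhood of \<open>S\<close>.\<close>

lemma admissible_exchange:
  assumes "exchange_graph A B L" "S \<subseteq> A"
  shows "admissible (A \<union> B) L (indicator (A - S \<union> neighbourhood L S))"
  unfolding admissible_def policy_def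
proof (intro conjI ballI impI)
  fix u v assume "adjacent L u v"
  \<comment> \<open>The edge is read from its endpoint in \<open>A\<close>; symmetry of adjacency
    then covers both orientations of \<open>u\<close> and \<open>v\<close>.\<close>
  moreover have "x \<in> A - S \<union> neighbourhood L S \<or> y \<in> A - S \<union> neighbourhood L S"
    if "x \<in> A" "adjacent L x y" for x y
    using that by (auto simp: neighbourhood_def)
  ultimately have "u \<in> A - S \<union> neighbourhood L S \<or> v \<in> A - S \<union> neighbourhood L S"
    using adjacent_cases[OF assms(1)] adjacent_commute by metis
  then show "1 \<le> indicator (A - S \<union> neighbourhood L S) u
    + (indicator (A - S \<union> neighbourhood L S) v :: nat)"
    by (auto simp: indicator_def)
qed (auto simp: indicator_def)

text \<open>The neighbourhood of \<open>S\<close> lies in \<open>B\<close>, hence is disjoint from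
  \<open>A - S\<close>, and the sum splits.\<close>

lemma sum_exchange:
  fixes w :: "'a \<Rightarrow> real"
  assumes "exchange_graph A B L" "S \<subseteq> A"
  shows "sum w (A - S \<union> neighbourhood L S) = sum w A - sum w S + sum w (neighbourhood L S)"
proof -
  have fin: "finite A" "finite B" and dj: "A \<inter> B = {}"
    using assms(1) by (auto simp: exchange_graph_def)
  have "neighbourhood L S \<subseteq> B"
    using neighbourhood_subset[OF assms] .
  then have "sum w (A - S \<union> neighbourhood L S) = sum w (A - S) + sum w (neighbourhood L S)"
    using fin dj by (intro sum.union_disjoint) (auto intro: finite_subset)
  then show ?thesis
    using fin assms(2) by (simp add: sum_diff)
qed

text \<open>Here \<open>A\<close> is the class that carries the monolog, whichever of the two it is,
  so one argument serves both choices.\<close>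

lemma monolog_minimal_iff:
  fixes w :: "'a \<Rightarrow> real"
  assumes graph: "exchange_graph A B L"
    and w: "\<forall>v\<in>A \<union> B. w v \<ge> 0"
    and \<pi>o: "\<forall>v\<in>A \<union> B. \<pi>o v = (if v \<in> A then 1 else 0)"
  shows "is_arg_min (cost (A \<union> B) w) (admissible (A \<union> B) L) \<pi>o \<longleftrightarrow>
         (\<forall>S\<subseteq>A. sum w S \<le> sum w (neighbourhood L S))"
proof -
  have fin: "finite (A \<union> B)" and dj: "A \<inter> B = {}"
    using graph by (auto simp: exchange_graph_def)
  have "policy (A \<union> B) \<pi>o"
    using \<pi>o by (simp add: policy_def)
  moreover have "{v \<in> A \<union> B. \<pi>o v = 1} = A"
    using \<pi>o by (auto split: if_splits)
  ultimately have cost_o: "cost (A \<union> B) w \<pi>o = sum w A"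
    using cost_eq_sum[OF fin] by simp
  have adm_o: "admissible (A \<union> B) L \<pi>o"
    using \<pi>o adjacent_cases[OF graph] unfolding admissible_def policy_def by (auto simp: Pi_iff)
  show ?thesis
  proof (intro iffI allI impI)
    fix S assume min: "is_arg_min (cost (A \<union> B) w) (admissible (A \<union> B) L) \<pi>o" and S: "S \<subseteq> A"
    \<comment> \<open>The support of the competitor against which minimality of
      \<open>\<pi>o\<close> is tested.\<close>
    let ?C = "A - S \<union> neighbourhood L S"
    have adm: "admissible (A \<union> B) L (indicator ?C)"
      using admissible_exchange[OF graph S] .
    have "{v \<in> A \<union> B. indicator ?C v = (1::nat)} = ?C"
      using neighbourhood_subset[OF graph S] by (auto simp: indicator_def)
    then have "cost (A \<union> B) w (indicator ?C) = sum w ?C"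
      using cost_eq_sum[OF fin] adm by (simp add: admissible_def)
    moreover have "cost (A \<union> B) w \<pi>o \<le> cost (A \<union> B) w (indicator ?C)"
      using min adm by (auto simp: is_arg_min_linorder)
    ultimately show "sum w S \<le> sum w (neighbourhood L S)"
      using sum_exchange[OF graph S, of w] cost_o by simp
  next
    assume hall: "\<forall>S\<subseteq>A. sum w S \<le> sum w (neighbourhood L S)"
    have "sum w A \<le> cost (A \<union> B) w \<pi>" if adm: "admissible (A \<union> B) L \<pi>" for \<pi>
    proof -
      \<comment> \<open>The vertices of \<open>A\<close> that \<open>\<pi>\<close> drops; the
        hypothesis \<open>hall\<close> is applied to this set.\<close>
      define S where "S = {v \<in> A. \<pi> v = 0}"
      have S: "S \<subseteq> A"
        by (auto simp: S_def)
      have pol: "policy (A \<union> B) \<pi>"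
        using adm by (simp add: admissible_def)
      then have bin: "\<pi> v = 0 \<or> \<pi> v = 1" if "v \<in> A \<union> B" for v
        using that by (auto simp: policy_def Pi_iff)
      have "\<pi> v = 1" if "v \<in> neighbourhood L S" for v
      proof -
        obtain u where u: "u \<in> S" "adjacent L u v"
          using \<open>v \<in> neighbourhood L S\<close> by (auto simp: neighbourhood_def)
        have v: "v \<in> B"
          using neighbourhood_subset[OF graph S] that by blast
        have "\<pi> u + \<pi> v \<ge> 1"
          using adm u v S by (auto simp: admissible_def)
        then show ?thesis
          using u v bin[of v] by (simp add: S_def)
      qed
      then have "A - S \<union> neighbourhood L S \<subseteq> {v \<in> A \<union> B. \<pi> v = 1}"
        using bin neighbourhood_subset[OF graph S] by (fastforce simp: S_def)
      \<comment> \<open>The support of \<open>\<pi>\<close> may contain further vertices of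
        \<open>B\<close>; as weights are non-negative, these can only raise the cost.\<close>
      then have "sum w (A - S \<union> neighbourhood L S) \<le> cost (A \<union> B) w \<pi>"
        unfolding cost_eq_sum[OF fin pol] using fin w by (intro sum_mono2) auto
      then show ?thesis
        using sum_exchange[OF graph S, of w] hall S by (smt (verit))
    qed
    then show "is_arg_min (cost (A \<union> B) w) (admissible (A \<union> B) L) \<pi>o"
      using adm_o cost_o by (simp add: is_arg_min_linorder)
  qed
qed

theorem theorem1:
  fixes V1 V2 V Vo :: "'a set" and L :: "'a set set"
    and w :: "'a \<Rightarrow> real" and \<pi>o :: "'a \<Rightarrow> nat"
  assumes "exchange_graph V1 V2 L"
    and "V = V1 \<union> V2"
    and "\<forall>v\<in>V. w v \<ge> 0"
    and "Vo \<in> {V1, V2}"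
    and "\<forall>v\<in>V. \<pi>o v = (if v \<in> Vo then 1 else 0)"
  shows "is_arg_min (cost V w) (admissible V L) \<pi>o \<longleftrightarrow>
         (\<forall>S\<subseteq>Vo. (\<Sum>v\<in>S. w v) \<le> (\<Sum>v\<in>neighbourhood L S. w v))"
proof -
  \<comment> \<open>\<open>Vc\<close> is the class other than \<open>Vo\<close>; if
    \<open>Vo\<close> is \<open>V2\<close>, the two classes of the graph are swapped.\<close>
  obtain Vc where "exchange_graph Vo Vc L" "V = Vo \<union> Vc"
    using assms(1,2,4) exchange_graph_commute by blast
  then show ?thesis
    using monolog_minimal_iff assms(3,5) by metis
qed

end
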